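(* Let $S_0=0$ and $S_j=\sum_{i=1}^jX_i$ for $1\le j\le n$, where $X_1,\ldots,X_n$ are exchangeable real random variables such that almost surely no two distinct non-empty subsets of $X_1,\ldots,X_n$ have the same arithmetic mean, and let $S^{[0,n]}=\{(j,S_j):0\le j\le n\}$. Let $U$ be distributed uniformly on $[n]=\{1,\ldots,n\}$, independently of $X_1,\ldots,X_n$. Let $g$ and $d$ be the left and right end points respectively of the face of the concave majorant of $S^{[0,n]}$ containing the $U$th increment $X_U$ (so $g<U\le d$). Define $$S_j^U=\begin{cases}S_{U+j}-S_U&\text{for }0\le j<d-U,\\ S_{g+j-(d-U)}+S_d-S_g-S_U&\text{for }d-U\le j<d-g,\\ S_{j-(d-g)}+S_d-S_g&\text{for }d-g\le j<d,\\ S_j&\text{for }d\le j\le n,\end{cases}$$ and let $S_U^{[0,n]}=\{(j,S_j^U):0\le j\le n\}$. Then $$(U,S^{[0,n]})\ \text{and}\ (d-g,S_U^{[0,n]})\ \text{have the same distribution}.$$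
   Context: The concave majorant of $S^{[0,n]}$ is the least concave function $C$ on $[0,n]$ with $C(j)\ge S_j$ for $0\le j\le n$. Its faces are its maximal linear pieces; the end points of a face are the end points of the corresponding subinterval of $[0,n]$ (which are integers). *)

theory Defs
  imports "HOL-Probability.Probability" "HOL-Combinatorics.Permutations"
begin

definition walk :: "(nat \<Rightarrow> real) \<Rightarrow> nat \<Rightarrow> real" where
  "walk x j = (\<Sum>i=1..j. x i)"

definition mean_of :: "(nat \<Rightarrow> real) \<Rightarrow> nat set \<Rightarrow> real" where
  "mean_of x A = (\<Sum>i\<in>A. x i) / real (card A)"

text \<open>Only meaningful when every \<open>X i\<close> with \<open>i \<in> I\<close> is a random variable with values in \<open>N\<close>.\<close>

definition exchangeable :: "'a measure \<Rightarrow> 'b measure \<Rightarrow> 'i set \<Rightarrow> ('i \<Rightarrow> 'a \<Rightarrow> 'b) \<Rightarrow> bool" where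
  "exchangeable M N I X \<longleftrightarrow>
     (\<forall>\<pi>. \<pi> permutes I \<longrightarrow>
        distr M (\<Pi>\<^sub>M i\<in>I. N) (\<lambda>\<omega>. \<lambda>i\<in>I. X (\<pi> i) \<omega>) = distr M (\<Pi>\<^sub>M i\<in>I. N) (\<lambda>\<omega>. \<lambda>i\<in>I. X i \<omega>))"

definition is_concave_majorant :: "nat \<Rightarrow> (nat \<Rightarrow> real) \<Rightarrow> (real \<Rightarrow> real) \<Rightarrow> bool" where
  "is_concave_majorant n s C \<longleftrightarrow>
     concave_on {0..real n} C \<and> (\<forall>j\<le>n. s j \<le> C (real j)) \<and>
     (\<forall>D. concave_on {0..real n} D \<and> (\<forall>j\<le>n. s j \<le> D (real j)) \<longrightarrow>
        (\<forall>x\<in>{0..real n}. C x \<le> D x))"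

definition linear_piece :: "(real \<Rightarrow> real) \<Rightarrow> real \<Rightarrow> real \<Rightarrow> bool" where
  "linear_piece C a b \<longleftrightarrow> a < b \<and> (\<exists>m c. \<forall>x\<in>{a..b}. C x = m * x + c)"

text \<open>Maximality is taken among all subintervals of \<open>[0,n]\<close> with real end points; that
  the end points of a face are integers is a consequence, see \<open>face_ends_unique\<close>.\<close>

definition is_face :: "nat \<Rightarrow> (real \<Rightarrow> real) \<Rightarrow> real \<Rightarrow> real \<Rightarrow> bool" where
  "is_face n C a b \<longleftrightarrow>
     0 \<le> a \<and> b \<le> real n \<and> linear_piece C a b \<and>
     (\<forall>a' b'. 0 \<le> a' \<and> a' \<le> a \<and> b \<le> b' \<and> b' \<le> real n \<and> linear_piece C a' b' \<longrightarrow>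
        a' = a \<and> b' = b)"

text \<open>The face containing the \<open>u\<close>th increment, \<open>1 \<le> u \<le> n\<close>, is the one whose interval contains
  \<open>[u - 1, u]\<close>. A concave majorant is determined only on \<open>[0,n]\<close>, and \<open>is_face n\<close>
  does not depend on its values elsewhere.\<close>

definition face_ends :: "nat \<Rightarrow> (nat \<Rightarrow> real) \<Rightarrow> nat \<Rightarrow> nat \<times> nat" where
  "face_ends n s u = (THE (g, d). g < u \<and> u \<le> d \<and>
     (\<exists>C. is_concave_majorant n s C \<and> is_face n C (real g) (real d)))"

definition face_left :: "nat \<Rightarrow> (nat \<Rightarrow> real) \<Rightarrow> nat \<Rightarrow> nat" where
  "face_left n s u = fst (face_ends n s u)"

definition face_right :: "nat \<Rightarrow> (nat \<Rightarrow> real) \<Rightarrow> nat \<Rightarrow> nat" where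
  "face_right n s u = snd (face_ends n s u)"

text \<open>Since \<open>g < u \<le> d\<close>, the natural-number subtractions below do not truncate in the
  cases in which they are used.\<close>

definition transformed_walk :: "nat \<Rightarrow> (nat \<Rightarrow> real) \<Rightarrow> nat \<Rightarrow> nat \<Rightarrow> real" where
  "transformed_walk n s u j =
     (let g = face_left n s u; d = face_right n s u in
      if j < d - u then s (u + j) - s u
      else if j < d - g then s (g + (j - (d - u))) + s d - s g - s u
      else if j < d then s (j - (d - g)) + s d - s g
      else s j)"


lemma is_concave_majorant_ex: "\<exists>C. is_concave_majorant n s C"
proof -
  define F where "F = {D. concave_on {0..real n} D \<and> (\<forall>j\<le>n. s j \<le> D (real j))}"
  define C where "C x = (INF D\<in>F. D x)" for x
  have ne: "(\<lambda>_. Max (s ` {..n})) \<in> F"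
    by (auto simp: F_def concave_on_const)
  have lowb: "min (s 0) (s n) \<le> D x" if "D \<in> F" "x \<in> {0..real n}" for D x
  proof (cases "n = 0")
    case True
    with that show ?thesis by (auto simp: F_def)
  next
    case False
    have c: "concave_on {0..real n} D" and s: "s 0 \<le> D 0" "s n \<le> D (real n)"
      using that by (auto simp: F_def)
    define t where "t = x / real n"
    have t: "0 \<le> t" "t \<le> 1" "x = t * real n"
      using that False by (auto simp: t_def)
    have "(1 - t) * D 0 + t * D (real n) \<le> D ((1 - t) *\<^sub>R 0 + t *\<^sub>R real n)"
      by (rule concave_onD[OF c]) (use t in auto)
    then have "(1 - t) * D 0 + t * D (real n) \<le> D x"
      using t by simp
    moreover have "(1 - t) * min (s 0) (s n) \<le> (1 - t) * D 0"
      using t s by (intro mult_left_mono) auto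
    moreover have "t * min (s 0) (s n) \<le> t * D (real n)"
      using t s by (intro mult_left_mono) auto
    moreover have "(1 - t) * min (s 0) (s n) + t * min (s 0) (s n) = min (s 0) (s n)"
      by (simp add: algebra_simps)
    ultimately show ?thesis by linarith
  qed
  have bdd: "bdd_below ((\<lambda>D. D x) ` F)" if "x \<in> {0..real n}" for x
    using lowb that by (intro bdd_belowI2) auto
  have le: "C x \<le> D x" if "D \<in> F" "x \<in> {0..real n}" for D x
    unfolding C_def using that bdd by (intro cINF_lower) auto
  have ge: "m \<le> C x" if "\<And>D. D \<in> F \<Longrightarrow> m \<le> D x" for m x
    unfolding C_def using that ne by (intro cINF_greatest) auto
  have "concave_on {0..real n} C"
    unfolding concave_on_iff
  proof (intro conjI ballI allI impI)
    fix x y u v :: real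
    assume xy: "x \<in> {0..real n}" "y \<in> {0..real n}" and uv: "0 \<le> u" "0 \<le> v" "u + v = 1"
    show "u * C x + v * C y \<le> C (u *\<^sub>R x + v *\<^sub>R y)"
    proof (rule ge)
      fix D assume D: "D \<in> F"
      have "u * C x + v * C y \<le> u * D x + v * D y"
        using xy uv le[OF D] by (intro add_mono mult_left_mono) auto
      also have "\<dots> \<le> D (u *\<^sub>R x + v *\<^sub>R y)"
        using D xy uv by (auto simp: F_def concave_on_iff)
      finally show "u * C x + v * C y \<le> D (u *\<^sub>R x + v *\<^sub>R y)" .
    qed
  qed auto
  moreover have "s j \<le> C (real j)" if "j \<le> n" for j
    using that by (intro ge) (auto simp: F_def)
  ultimately have "is_concave_majorant n s C"
    unfolding is_concave_majorant_def using le by (auto simp: F_def)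
  then show ?thesis by blast
qed

lemma is_concave_majorantD:
  assumes "is_concave_majorant n s C"
  shows "concave_on {0..real n} C"
    and "\<And>j. j \<le> n \<Longrightarrow> s j \<le> C (real j)"
    and "\<And>D x. concave_on {0..real n} D \<Longrightarrow> (\<And>j. j \<le> n \<Longrightarrow> s j \<le> D (real j)) \<Longrightarrow>
           x \<in> {0..real n} \<Longrightarrow> C x \<le> D x"
proof -
  note c = assms[unfolded is_concave_majorant_def]
  show "concave_on {0..real n} C" by (rule conjunct1[OF c])
  show "s j \<le> C (real j)" if "j \<le> n" for j
    using conjunct1[OF conjunct2[OF c]] that by blast
  fix D x assume "concave_on {0..real n} D" "\<And>j. j \<le> n \<Longrightarrow> s j \<le> D (real j)" "x \<in> {0..real n}"
  then show "C x \<le> D x"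
    using spec[OF conjunct2[OF conjunct2[OF c]], of D] by blast
qed

lemma is_concave_majorant_unique:
  assumes C: "is_concave_majorant n s C" and D: "is_concave_majorant n s D" and x: "x \<in> {0..real n}"
  shows "C x = D x"
  by (intro order_antisym is_concave_majorantD(3)[OF C is_concave_majorantD(1,2)[OF D] x]
      is_concave_majorantD(3)[OF D is_concave_majorantD(1,2)[OF C] x])

lemma concave_line_cmp:
  fixes C :: "real \<Rightarrow> real"
  assumes c: "concave_on S C" and S: "x \<in> S" "z \<in> S" and xyz: "x < y" "y < z"
  shows "(z - y) * C x + (y - x) * C z \<le> (z - x) * C y"
proof -
  define t where "t = (y - x) / (z - x)"
  have t: "0 \<le> t" "t \<le> 1" "t * (z - x) = y - x"
    using xyz by (auto simp: t_def)
  then have y: "(1 - t) *\<^sub>R x + t *\<^sub>R z = y"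
    by (simp add: algebra_simps)
  have "(1 - t) * C x + t * C z \<le> C y"
    using concave_onD[OF c, of t x z] t S y by simp
  then have "(z - x) * ((1 - t) * C x + t * C z) \<le> (z - x) * C y"
    using xyz by (intro mult_left_mono) auto
  moreover have "(z - x) * ((1 - t) * C x + t * C z)
      = ((z - x) - t * (z - x)) * C x + t * (z - x) * C z"
    by (simp add: algebra_simps)
  ultimately show ?thesis
    using t(3) by simp
qed

lemma majorant_linear_step:
  assumes C: "is_concave_majorant n s C" and u: "u < n"
  shows "linear_piece C (real u) (real (Suc u))"
proof -
  define m where "m = C (real (Suc u)) - C (real u)"
  define l where "l x = m * x + (C (real u) - m * real u)" for x
  define D where "D x = min (C x) (l x)" for x
  note cC = is_concave_majorantD(1)[OF C] and maj = is_concave_majorantD(2)[OF C]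
  have lu: "l (real u) = C (real u)" "l (real u + 1) = C (real u + 1)"
    by (auto simp: l_def m_def algebra_simps)
  have below: "C x \<le> l x" if x: "x \<in> {0..real n}" "x < real u" for x
    using concave_line_cmp[OF cC, of x "real u + 1" "real u"] x u
    by (simp add: l_def m_def algebra_simps)
  have above: "C x \<le> l x" if x: "x \<in> {0..real n}" "real u + 1 < x" for x
    using concave_line_cmp[OF cC, of "real u" x "real u + 1"] x u
    by (simp add: l_def m_def algebra_simps)
  have inside: "l x \<le> C x" if x: "real u < x" "x < real u + 1" for x
    using concave_line_cmp[OF cC, of "real u" "real u + 1" x] x u
    by (simp add: l_def m_def algebra_simps)
  have cD: "concave_on {0..real n} D"
    unfolding concave_on_iff
  proof (intro conjI ballI allI impI)
    fix x y a b :: real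
    assume xy: "x \<in> {0..real n}" "y \<in> {0..real n}" and ab: "0 \<le> a" "0 \<le> b" "a + b = 1"
    have "a * D x + b * D y \<le> a * C x + b * C y"
      using ab by (intro add_mono mult_left_mono) (auto simp: D_def)
    also have "\<dots> \<le> C (a *\<^sub>R x + b *\<^sub>R y)"
      using cC xy ab by (auto simp: concave_on_iff)
    finally have 1: "a * D x + b * D y \<le> C (a *\<^sub>R x + b *\<^sub>R y)" .
    have b: "b = 1 - a" using ab by simp
    have "a * D x + b * D y \<le> a * l x + b * l y"
      using ab by (intro add_mono mult_left_mono) (auto simp: D_def)
    also have "\<dots> = l (a *\<^sub>R x + b *\<^sub>R y)"
      unfolding l_def b by (simp add: algebra_simps)
    finally show "a * D x + b * D y \<le> D (a *\<^sub>R x + b *\<^sub>R y)"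
      using 1 by (auto simp: D_def)
  qed auto
  have majD: "s j \<le> D (real j)" if j: "j \<le> n" for j
  proof -
    consider "j < u" | "j = u" | "j = Suc u" | "Suc u < j" by linarith
    then have "C (real j) \<le> l (real j)"
      using below[of "real j"] above[of "real j"] lu j by cases (auto simp: add.commute)
    then show ?thesis using maj[OF j] by (auto simp: D_def)
  qed
  have CD: "C x \<le> D x" if "x \<in> {0..real n}" for x
    by (rule is_concave_majorantD(3)[OF C cD majD that])
  have "C x = l x" if x: "x \<in> {real u..real (Suc u)}" for x
  proof -
    have "real u \<le> x" "x \<le> real u + 1"
      using x by simp_all
    then consider "x = real u" | "x = real u + 1" | "real u < x" "x < real u + 1"
      by linarith
    then show ?thesis
      using lu inside[of x] CD[of x] x u by cases (auto simp: D_def)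
  qed
  then have "\<forall>x\<in>{real u..real (Suc u)}. C x = m * x + (C (real u) - m * real u)"
    unfolding l_def by blast
  then have "\<exists>m c. \<forall>x\<in>{real u..real (Suc u)}. C x = m * x + c"
    by (intro exI)
  moreover have "real u < real (Suc u)" by simp
  ultimately show ?thesis
    unfolding linear_piece_def by blast
qed

lemma linear_piece_mono:
  assumes "linear_piece C a b" "a \<le> a'" "a' < b'" "b' \<le> b"
  shows "linear_piece C a' b'"
  using assms unfolding linear_piece_def by force

lemma linear_piece_glue:
  assumes 1: "linear_piece C a b" and 2: "linear_piece C a' b'"
    and ov: "max a a' < min b b'"
  shows "linear_piece C (min a a') (max b b')"
proof -
  obtain m c where m: "\<And>x. x \<in> {a..b} \<Longrightarrow> C x = m * x + c"
    using 1 unfolding linear_piece_def by blast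
  obtain m' c' where m': "\<And>x. x \<in> {a'..b'} \<Longrightarrow> C x = m' * x + c'"
    using 2 unfolding linear_piece_def by blast
  define p q where "p = max a a'" and "q = min b b'"
  have pq: "p < q" "p \<in> {a..b}" "p \<in> {a'..b'}" "q \<in> {a..b}" "q \<in> {a'..b'}"
    using ov by (auto simp: p_def q_def)
  have e: "m * p + c = m' * p + c'" "m * q + c = m' * q + c'"
    using m[of p] m'[of p] m[of q] m'[of q] pq by auto
  then have "(m - m') * (q - p) = 0"
    by (simp add: algebra_simps)
  with pq e have eq: "m = m'" "c = c'" by auto
  have "C x = m * x + c" if x: "x \<in> {min a a'..max b b'}" for x
  proof -
    have "x \<in> {a..b} \<or> x \<in> {a'..b'}"
      using x ov by (auto simp: min_def max_def split: if_splits)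
    then show ?thesis using m m' eq by auto
  qed
  then show ?thesis
    using ov unfolding linear_piece_def by (auto simp: min_def max_def split: if_splits)
qed

lemma finite_has_max_measure:
  fixes f :: "'a \<Rightarrow> nat"
  assumes "finite P" "q \<in> P"
  shows "\<exists>p\<in>P. \<forall>q\<in>P. f q \<le> f p"
proof -
  have "Max (f ` P) \<in> f ` P"
    using assms by (intro Max_in) auto
  then obtain p where "p \<in> P" "f p = Max (f ` P)" by auto
  then show ?thesis using assms by (intro bexI[of _ p]) auto
qed

lemma face_ex:
  assumes C: "is_concave_majorant n s C" and u: "0 < u" "u \<le> n"
  shows "\<exists>g d. g < u \<and> u \<le> d \<and> is_face n C (real g) (real d)"
proof -
  define P where "P = {(g, d). g < u \<and> u \<le> d \<and> d \<le> n \<and> linear_piece C (real g) (real d)}"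
  have "finite P"
    by (rule finite_subset[of _ "{..n} \<times> {..n}"]) (use u in \<open>auto simp: P_def\<close>)
  moreover have "(u - 1, u) \<in> P"
    using majorant_linear_step[OF C, of "u - 1"] u by (auto simp: P_def)
  ultimately obtain p where p: "p \<in> P" "\<And>q. q \<in> P \<Longrightarrow> snd q - fst q \<le> snd p - fst p"
    using finite_has_max_measure[of P "(u - 1, u)" "\<lambda>p. snd p - fst p"] by blast
  obtain g d where gd: "p = (g, d)" by (cases p)
  have P: "g < u" "u \<le> d" "d \<le> n" "linear_piece C (real g) (real d)"
    using p(1) by (auto simp: gd P_def)
  have mx: "d' - g' \<le> d - g" if "(g', d') \<in> P" for g' d'
    using p(2)[OF that] by (simp add: gd)
  have "is_face n C (real g) (real d)"
    unfolding is_face_def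
  proof (intro conjI allI impI)
    fix a' b' assume ab: "0 \<le> a' \<and> a' \<le> real g \<and> real d \<le> b' \<and> b' \<le> real n \<and> linear_piece C a' b'"
    show "a' = real g"
    proof (rule ccontr)
      assume "a' \<noteq> real g"
      then have a: "a' < real g" "0 < g" using ab by auto
      have "linear_piece C (real (g - 1)) (real (Suc (g - 1)))"
        using a P by (intro majorant_linear_step[OF C]) auto
      then have "linear_piece C (min (real (g - 1)) a') (max (real g) b')"
        using a ab P by (intro linear_piece_glue) (auto simp: linear_piece_def)
      then have "linear_piece C (real (g - 1)) (real d)"
        using ab P by (rule_tac linear_piece_mono) auto
      then have "(g - 1, d) \<in> P" using P by (auto simp: P_def)
      from mx[OF this] a P show False by linarith
    qed
    show "b' = real d"
    proof (rule ccontr)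
      assume "b' \<noteq> real d"
      then have b: "real d < b'" "d < n" using ab by auto
      have "linear_piece C (real d) (real (Suc d))"
        using b by (intro majorant_linear_step[OF C]) auto
      then have "linear_piece C (min (real d) a') (max (real (Suc d)) b')"
        using b ab P by (intro linear_piece_glue) (auto simp: linear_piece_def)
      then have "linear_piece C (real g) (real (Suc d))"
        using ab P by (rule_tac linear_piece_mono) auto
      then have "(g, Suc d) \<in> P" using P b by (auto simp: P_def)
      from mx[OF this] P show False by linarith
    qed
  qed (use P in auto)
  with P show ?thesis by blast
qed

lemma is_faceD:
  assumes "is_face n C a b"
  shows "0 \<le> a" "b \<le> real n" "linear_piece C a b"
    and "\<And>a' b'. 0 \<le> a' \<Longrightarrow> a' \<le> a \<Longrightarrow> b \<le> b' \<Longrightarrow> b' \<le> real n \<Longrightarrow> linear_piece C a' b' \<Longrightarrow>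
           a' = a \<and> b' = b"
proof -
  note f = assms[unfolded is_face_def]
  show "0 \<le> a" by (rule conjunct1[OF f])
  show "b \<le> real n" by (rule conjunct1[OF conjunct2[OF f]])
  show "linear_piece C a b" by (rule conjunct1[OF conjunct2[OF conjunct2[OF f]]])
  fix a' b' assume "0 \<le> a'" "a' \<le> a" "b \<le> b'" "b' \<le> real n" "linear_piece C a' b'"
  then show "a' = a \<and> b' = b"
    by (intro conjunct2[OF conjunct2[OF conjunct2[OF f]], rule_format] conjI)
qed

lemma face_unique:
  assumes 1: "is_face n C a b" and 2: "is_face n C a' b'" and ov: "max a a' < min b b'"
  shows "a = a' \<and> b = b'"
proof -
  have u: "linear_piece C (min a a') (max b b')"
    by (rule linear_piece_glue[OF is_faceD(3)[OF 1] is_faceD(3)[OF 2] ov])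
  have r: "0 \<le> min a a'" "max b b' \<le> real n"
    using is_faceD(1,2)[OF 1] is_faceD(1,2)[OF 2] by simp_all
  have "min a a' = a \<and> max b b' = b"
    by (rule is_faceD(4)[OF 1 r(1) _ _ r(2) u]) simp_all
  moreover have "min a a' = a' \<and> max b b' = b'"
    by (rule is_faceD(4)[OF 2 r(1) _ _ r(2) u]) simp_all
  ultimately show ?thesis by metis
qed

lemma is_face_cong:
  assumes eq: "\<And>x. x \<in> {0..real n} \<Longrightarrow> C x = D x" and f: "is_face n C a b"
  shows "is_face n D a b"
proof -
  have lp: "linear_piece C a b \<longleftrightarrow> linear_piece D a b" if "0 \<le> a" "b \<le> real n" for a b
    using that eq unfolding linear_piece_def by auto
  show ?thesis
    unfolding is_face_def
  proof (intro conjI allI impI)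
    show "0 \<le> a" "b \<le> real n" by (rule is_faceD[OF f])+
    then show "linear_piece D a b" using lp is_faceD(3)[OF f] by blast
    fix a' b' assume h: "0 \<le> a' \<and> a' \<le> a \<and> b \<le> b' \<and> b' \<le> real n \<and> linear_piece D a' b'"
    then have "a' = a \<and> b' = b"
      using lp[of a' b'] by (intro is_faceD(4)[OF f]) blast+
    then show "a' = a" "b' = b" by blast+
  qed
qed

lemma face_ends_unique:
  assumes C: "is_concave_majorant n s C" and u: "0 < u" "u \<le> n"
    and ab: "is_face n C a b" "a \<le> real u - 1" "real u \<le> b"
  shows "a = real (face_left n s u)" "b = real (face_right n s u)"
proof -
  obtain g d where gd: "g < u" "u \<le> d" "is_face n C (real g) (real d)"
    using face_ex[OF C u] by blast
  have "face_ends n s u = (g, d)"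
    unfolding face_ends_def
  proof (rule the_equality)
    fix p assume "case p of (g, d) \<Rightarrow> g < u \<and> u \<le> d \<and>
      (\<exists>C. is_concave_majorant n s C \<and> is_face n C (real g) (real d))"
    then obtain g' d' C' where p: "p = (g', d')" "g' < u" "u \<le> d'"
      "is_concave_majorant n s C'" "is_face n C' (real g') (real d')"
      by (cases p) auto
    have "is_face n C (real g') (real d')"
      using p(5) is_concave_majorant_unique[OF p(4) C] by (rule is_face_cong[rotated])
    with face_unique[OF gd(3) this] gd p show "p = (g, d)" by auto
  qed (use gd C in auto)
  moreover have "a = real g \<and> b = real d"
    using gd ab by (intro face_unique) auto
  ultimately show "a = real (face_left n s u)" "b = real (face_right n s u)"
    by (auto simp: face_left_def face_right_def)
qed

end

theory Submission
  imports Defs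
begin

text \<open>
  Fix the values $x_1,\dots,x_n$ and suppose that no two non-empty subsets of them have the same
  mean. For a permutation \<open>\<sigma>\<close> of $\{1,\dots,n\}$ consider the walk with
  increments \<open>x \<circ> \<sigma>\<close>, let \<open>(g, d)\<close> be the face containing its
  \<open>u\<close>th increment, and reorder the increments as in the definition of the transformed
  walk: first the face, cut open after \<open>u\<close> and rotated, then the increments before it,
  then those after it. This produces a pair consisting of the face length \<open>d - g\<close> and a
  new permutation, and the map \<open>path_perm\<close>, which takes \<open>(u, \<sigma>)\<close> to
  that pair, sends the finite set of all pairs to itself. The theorem holds because this map is a
  bijection (\<open>path_perm_bij\<close>): given the values of the increments, the pair (index,
  order of the increments) is uniform in the source, so it is uniform in the target.

  Because the set is finite, injectivity suffices (\<open>path_perm_inj\<close>). Let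
  \<open>T\<close> be the reordered walk, \<open>k\<close> the face length and \<open>m = T k /
  k\<close>, which is the slope of the face. The face lies on a line above the whole walk, so after
  subtracting the drift \<open>m\<close> the original walk is maximal at \<open>g\<close> and at
  \<open>d\<close>. In terms of \<open>R j = T j - m * j\<close>, this says that \<open>R\<close>
  attains its maximum over \<open>k \<le> j \<le> n\<close> at \<open>d\<close> and its maximum over
  \<open>0 \<le> j < k\<close> at \<open>d - u\<close> (\<open>transformed_walk_maximal\<close>).
  Two maximisers within one of these ranges would give a block of increments with the same mean as
  the first \<open>k\<close> ones, so \<open>d\<close> and \<open>u\<close>, and with them
  \<open>g\<close> and \<open>\<sigma>\<close>, can be recovered from \<open>k\<close> and the new
  permutation.

  The probabilistic part is an averaging argument (\<open>emeasure_uniform_exchangeable\<close>): by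
  exchangeability and independence, the probability of an event in terms of \<open>(U, X)\<close> is
  the expected proportion of pairs \<open>(u, \<sigma>)\<close> for which the event holds for
  \<open>u\<close> and the \<open>\<sigma>\<close>-permuted increments. The bijection rearranges
  this sum almost surely. The averaging requires that the transformed walk be a measurable function
  of the increments, also where some means coincide; this comes from a description of the faces by
  finitely many inequalities (\<open>face_ends_eq_iff\<close>).
\<close>

section \<open>Faces as dominating chords\<close>

definition slope :: "(nat \<Rightarrow> real) \<Rightarrow> nat \<Rightarrow> nat \<Rightarrow> real" where
  "slope s g d = (s d - s g) / (real d - real g)"

text \<open>
  A combinatorial form of the statement that \<open>[g, d]\<close> is a face: the chord from \<open>g\<close> to \<open>d\<close>
  dominates the sequence, strictly outside \<open>[g, d]\<close>. Contacts strictly between \<open>g\<close> and \<open>d\<close> are allowed,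
  so that every sequence is covered, not only generic ones.
\<close>

definition hull_edge :: "nat \<Rightarrow> (nat \<Rightarrow> real) \<Rightarrow> nat \<Rightarrow> nat \<Rightarrow> bool" where
  "hull_edge n s g d \<longleftrightarrow> g < d \<and> d \<le> n \<and>
     (\<forall>i\<le>n. s i \<le> s g + slope s g d * (real i - real g)) \<and>
     (\<forall>i\<le>n. i < g \<or> d < i \<longrightarrow> s i < s g + slope s g d * (real i - real g))"

lemma concave_on_affine: "convex S \<Longrightarrow> concave_on S (\<lambda>x::real. a + b * (x - c) :: real)"
proof -
  assume "convex S"
  have e: "a + b * (u * x + v * y - c) = u * (a + b * (x - c)) + v * (a + b * (y - c))"
    if "u + v = 1" for u v x y
  proof -
    have "v = 1 - u" using that by simp
    show ?thesis unfolding \<open>v = 1 - u\<close> by (simp add: algebra_simps)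
  qed
  show ?thesis
    unfolding concave_on_iff using \<open>convex S\<close> by (simp add: e)
qed

lemma majorant_le_affine:
  assumes C: "is_concave_majorant n s C"
    and "\<And>i. i \<le> n \<Longrightarrow> s i \<le> a + b * (real i - c)" and "x \<in> {0..real n}"
  shows "C x \<le> a + b * (x - c)"
  using is_concave_majorantD(3)[OF C, of "\<lambda>x. a + b * (x - c)"] assms
  by (simp add: concave_on_affine)

lemma positive_lower_bound:
  fixes f :: "'b \<Rightarrow> real"
  assumes "finite I" "\<And>i. i \<in> I \<Longrightarrow> 0 < f i"
  obtains e where "0 < e" "\<And>i. i \<in> I \<Longrightarrow> e \<le> f i"
proof
  show "0 < Min (insert 1 (f ` I))" using assms by (subst Min_gr_iff) auto
  show "Min (insert 1 (f ` I)) \<le> f i" if "i \<in> I" for i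
    using assms that by (intro Min_le) auto
qed

text \<open>
  The majorant lies below the line of the edge, since that line is itself a concave function above
  the sequence, and it touches the line at \<open>g\<close> and \<open>d\<close>; so it coincides with the line in between. It cannot
  follow the line any further: as the sequence stays strictly below the line outside
  \<open>[g, d]\<close>, the line can be tilted slightly about the end point \<open>g\<close> or \<open>d\<close> and still dominate the sequence, which
  pushes the majorant strictly below the original line beyond that end point.
\<close>

lemma hull_edge_is_face:
  assumes C: "is_concave_majorant n s C" and e: "hull_edge n s g d"
  shows "is_face n C (real g) (real d)"
proof -
  define m where "m = slope s g d"
  define L where "L x = s g + m * (x - real g)" for x
  have gd: "g < d" "d \<le> n" and below: "\<And>i. i \<le> n \<Longrightarrow> s i \<le> L (real i)"
    and strict: "\<And>i. i \<le> n \<Longrightarrow> i < g \<or> d < i \<Longrightarrow> s i < L (real i)"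
    using e unfolding hull_edge_def L_def m_def by auto
  have Lg: "L (real g) = s g" and Ld: "L (real d) = s d"
    using gd by (auto simp: L_def m_def slope_def)
  have CL: "C x \<le> L x" if "x \<in> {0..real n}" for x
    unfolding L_def by (rule majorant_le_affine[OF C below[unfolded L_def] that])
  have Cg: "C (real g) = L (real g)" and Cd: "C (real d) = L (real d)"
    using CL[of "real g"] CL[of "real d"] is_concave_majorantD(2)[OF C, of g]
      is_concave_majorantD(2)[OF C, of d] gd Lg Ld by auto
  have inside: "C x = L x" if x: "x \<in> {real g..real d}" for x
  proof (cases "x = real g \<or> x = real d")
    case False
    then have x': "real g < x" "x < real d" using x by auto
    have "(real d - x) * L (real g) + (x - real g) * L (real d) \<le> (real d - real g) * C x"
      using concave_line_cmp[OF is_concave_majorantD(1)[OF C], of "real g" "real d" x] x' gd Cg Cd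
      by auto
    moreover have "(real d - x) * L (real g) + (x - real g) * L (real d) = (real d - real g) * L x"
      by (simp add: L_def algebra_simps)
    ultimately have "L x \<le> C x" using gd by simp
    with CL[of x] x gd show ?thesis by auto
  qed (use Cg Cd in auto)
  have "linear_piece C (real g) (real d)"
  proof -
    have "\<forall>x\<in>{real g..real d}. C x = m * x + (s g - m * real g)"
      using inside by (simp add: L_def algebra_simps)
    with gd show ?thesis unfolding linear_piece_def by fastforce
  qed
  moreover have "a = real g \<and> b = real d"
    if ab: "0 \<le> a" "a \<le> real g" "real d \<le> b" "b \<le> real n" and lin: "linear_piece C a b" for a b
  proof -
    obtain p q where pq: "\<And>x. x \<in> {a..b} \<Longrightarrow> C x = p * x + q"
      using lin unfolding linear_piece_def by blast
    have eqs: "p * real g + q = L (real g)" "p * real d + q = L (real d)"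
      using pq[of "real g"] pq[of "real d"] ab gd Cg Cd by auto
    then have "(p - m) * (real d - real g) = 0"
      by (simp add: L_def algebra_simps)
    then have "p = m" using gd by simp
    with eqs(1) have on_line: "C x = L x" if "x \<in> {a..b}" for x
      using pq[OF that] by (simp add: L_def algebra_simps)
    \<comment> \<open>The line of slope \<open>m + \<epsilon>\<close> through the left end of the edge is lower than \<open>L\<close> to the left of \<open>g\<close>.\<close>
    have "\<not> a < real g"
    proof
      assume a: "a < real g"
      obtain \<epsilon> where \<epsilon>: "0 < \<epsilon>"
        "\<And>i. i \<in> {..<g} \<Longrightarrow> \<epsilon> \<le> (L (real i) - s i) / (real g - real i)"
        by (rule positive_lower_bound[of "{..<g}" "\<lambda>i. (L (real i) - s i) / (real g - real i)"])
          (use strict gd in auto)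
      have "s i \<le> s g + (m + \<epsilon>) * (real i - real g)" if i: "i \<le> n" for i
      proof (cases "i < g")
        case True
        then have "\<epsilon> * (real g - real i) \<le> L (real i) - s i"
          using \<epsilon>(2)[of i] by (simp add: pos_le_divide_eq)
        then show ?thesis by (simp add: L_def algebra_simps)
      next
        case False
        then have "0 \<le> \<epsilon> * (real i - real g)" using \<epsilon>(1) by simp
        with below[OF i] show ?thesis by (simp add: L_def algebra_simps)
      qed
      then have "C a \<le> s g + (m + \<epsilon>) * (a - real g)"
        using ab gd by (intro majorant_le_affine[OF C]) auto
      moreover have "C a = L a" using on_line ab gd by auto
      moreover have "\<epsilon> * (a - real g) < 0" using \<epsilon>(1) a by (simp add: mult_pos_neg)
      ultimately show False by (simp add: L_def algebra_simps)
    qed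
    \<comment> \<open>The line of slope \<open>m - \<epsilon>\<close> through the right end of the edge is lower than \<open>L\<close> to the right of \<open>d\<close>.\<close>
    moreover have "\<not> real d < b"
    proof
      assume b: "real d < b"
      obtain \<epsilon> where \<epsilon>: "0 < \<epsilon>"
        "\<And>i. i \<in> {d<..n} \<Longrightarrow> \<epsilon> \<le> (L (real i) - s i) / (real i - real d)"
        by (rule positive_lower_bound[of "{d<..n}" "\<lambda>i. (L (real i) - s i) / (real i - real d)"])
          (use strict gd in auto)
      have Ld': "L x = s d + m * (x - real d)" for x
        using Ld by (simp add: L_def algebra_simps)
      have "s i \<le> s d + (m - \<epsilon>) * (real i - real d)" if i: "i \<le> n" for i
      proof (cases "d < i")
        case True
        then have "\<epsilon> * (real i - real d) \<le> L (real i) - s i"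
          using \<epsilon>(2)[of i] i by (simp add: pos_le_divide_eq)
        then show ?thesis by (simp add: Ld' algebra_simps)
      next
        case False
        then have "0 \<le> \<epsilon> * (real d - real i)" using \<epsilon>(1) by simp
        with below[OF i] show ?thesis by (simp add: Ld' algebra_simps)
      qed
      then have "C b \<le> s d + (m - \<epsilon>) * (b - real d)"
        using ab gd by (intro majorant_le_affine[OF C]) auto
      moreover have "C b = L b" using on_line ab gd by auto
      moreover have "0 < \<epsilon> * (b - real d)" using \<epsilon>(1) b by simp
      ultimately show False by (simp add: Ld' algebra_simps)
    qed
    ultimately show ?thesis using ab by linarith
  qed
  ultimately show ?thesis
    unfolding is_face_def using gd by auto
qed

text \<open>
  The edge over \<open>[u - 1, u]\<close> lies on the chord that is highest above the midpoint of this interval,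
  among all chords that straddle it: a point above that chord could replace one of its end points
  and would raise the chord over the midpoint. The end points of the edge are the outermost
  contacts of the sequence with the line of the chord.
\<close>

lemma hull_edge_ex:
  assumes u: "0 < u" "u \<le> n"
  shows "\<exists>g d. g < u \<and> u \<le> d \<and> hull_edge n s g d"
proof -
  define t where "t = real u - 1 / 2"
  define V where "V p = (case p of (i, j) \<Rightarrow>
     (s i * (real j - t) + s j * (t - real i)) / (real j - real i))" for p
  define P where "P = {..<u} \<times> {u..n}"
  have "finite P" "P \<noteq> {}" using u by (auto simp: P_def)
  then have "\<exists>p\<in>P. \<forall>q\<in>P. V q \<le> V p"
    using Max_in[of "V ` P"] Max_ge[of "V ` P"] by (metis (no_types, lifting) finite_imageI image_iff image_is_empty)
  then obtain i j where ij: "i < u" "u \<le> j" "j \<le> n"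
    and mx: "\<And>i' j'. i' < u \<Longrightarrow> u \<le> j' \<Longrightarrow> j' \<le> n \<Longrightarrow> V (i', j') \<le> V (i, j)"
    unfolding P_def by fastforce
  define m where "m = slope s i j"
  define L where "L k = s i + m * (k - real i)" for k :: real
  have Lj: "s j = L (real j)" and Li: "s i = L (real i)"
    using ij by (auto simp: L_def m_def slope_def)
  have t: "real k < t" if "k < u" for k using that unfolding t_def by linarith
  have t': "t < real k" if "u \<le> k" for k using that unfolding t_def by linarith
  \<comment> \<open>The height over \<open>t\<close> of the chord from \<open>k\<close> to \<open>l\<close>, when its ends lie \<open>e\<close> and \<open>e'\<close> above the line \<open>L\<close>.\<close>
  have V: "V (k, l) = L t + (e * (real l - t) + e' * (t - real k)) / (real l - real k)"
    if "k < u" "u \<le> l" "s k = L (real k) + e" "s l = L (real l) + e'" for k l e e'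
    proof -
    have "s k * (real l - t) + s l * (t - real k)
        = L t * (real l - real k) + (e * (real l - t) + e' * (t - real k))"
      unfolding that L_def by (simp add: algebra_simps)
    then show ?thesis
      unfolding V_def prod.case using that(1,2) by (simp only: add_divide_distrib) simp
  qed
  have Vij: "V (i, j) = L t"
    using V[of i j 0 0] ij Li Lj by simp
  have below: "s k \<le> L (real k)" if k: "k \<le> n" for k
  proof (cases "k < u")
    case True
    have "(s k - L (real k)) * ((real j - t) / (real j - real k)) \<le> 0"
      using V[of k j "s k - L (real k)" 0] mx[of k j] True ij Vij Lj by simp
    moreover have "(real j - t) / (real j - real k) > 0"
      using True ij t' by simp
    ultimately show ?thesis by (meson diff_gt_0_iff_gt linorder_not_le mult_pos_pos)
  next
    case False
    have "(s k - L (real k)) * ((t - real i) / (real k - real i)) \<le> 0"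
      using V[of i k 0 "s k - L (real k)"] mx[of i k] False k ij Vij Li by simp
    moreover have "(t - real i) / (real k - real i) > 0"
      using False ij t by simp
    ultimately show ?thesis by (meson diff_gt_0_iff_gt linorder_not_le mult_pos_pos)
  qed
  \<comment> \<open>All contacts with the line; they need not be just \<open>i\<close> and \<open>j\<close>.\<close>
  define T where "T = {k. k \<le> n \<and> s k = L (real k)}"
  have T: "finite T" "i \<in> T" "j \<in> T" using ij Li Lj by (auto simp: T_def)
  define g d where "g = Min T" and "d = Max T"
  have gd: "g \<in> T" "d \<in> T" "g \<le> i" "j \<le> d"
    using T by (auto simp: g_def d_def intro: Min_in Max_in)
  have out: "k \<notin> T" if "k < g \<or> d < k" for k
    using that T(1) by (auto simp: g_def d_def dest: Min_le Max_ge simp flip: not_le)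
  have "g < d" using gd ij by linarith
  have sl: "slope s g d = m" using gd \<open>g < d\<close> by (auto simp: slope_def T_def L_def field_simps)
  have line: "L x = s g + slope s g d * (x - real g)" for x
    unfolding sl using gd by (simp add: T_def L_def algebra_simps)
  have "hull_edge n s g d"
    unfolding hull_edge_def line[symmetric]
  proof (intro conjI allI impI)
    fix k assume "k \<le> n" "k < g \<or> d < k"
    with below[of k] out[of k] show "s k < L (real k)" by (auto simp: T_def)
  qed (use below gd \<open>g < d\<close> in \<open>auto simp: T_def\<close>)
  with gd ij show ?thesis by (intro exI[of _ g] exI[of _ d]) auto
qed

text \<open>
  A dominating chord over \<open>[u - 1, u]\<close> is a face and hence the only face there; since such a chord
  exists, the inequalities in \<open>hull_edge\<close> characterise the face.
\<close>

lemma face_ends_eq_iff: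
  assumes u: "0 < u" "u \<le> n"
  shows "face_ends n s u = (g, d) \<longleftrightarrow> g < u \<and> u \<le> d \<and> hull_edge n s g d"
proof -
  have "face_ends n s u = (g, d)" if e: "g < u" "u \<le> d" "hull_edge n s g d" for g d
  proof -
    obtain C where C: "is_concave_majorant n s C" using is_concave_majorant_ex by blast
    from face_ends_unique[OF C u hull_edge_is_face[OF C e(3)]] e
    show ?thesis by (simp add: face_left_def face_right_def prod_eq_iff)
  qed
  with hull_edge_ex[OF u, of s] show ?thesis by fastforce
qed

section \<open>The rearrangement is a bijection\<close>

text \<open>
  Position \<open>i\<close> of the reordered sequence holds the increment from position \<open>face_first g d u i\<close> of the
  original one; the value at 0 only makes the function a permutation of the natural numbers.
\<close>

definition face_first :: "nat \<Rightarrow> nat \<Rightarrow> nat \<Rightarrow> nat \<Rightarrow> nat" where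
  "face_first g d u i =
     (if i = 0 then 0
      else if i \<le> d - u then u + i
      else if i \<le> d - g then g + (i - (d - u))
      else if i \<le> d then i - (d - g)
      else i)"

lemma face_first_permutes:
  assumes "g < u" "u \<le> d" "d \<le> n"
  shows "face_first g d u permutes {1..n}"
proof (rule bij_imp_permutes)
  have "inj_on (face_first g d u) {1..n}"
    using assms by (auto simp: inj_on_def face_first_def split: if_splits)
  moreover have "face_first g d u ` {1..n} \<subseteq> {1..n}"
    using assms by (auto simp: face_first_def)
  ultimately show "bij_betw (face_first g d u) {1..n} {1..n}"
    unfolding bij_betw_def by (simp add: endo_inj_surj)
qed (use assms in \<open>auto simp: face_first_def\<close>)

lemma walk_0 [simp]: "walk x 0 = 0"
  by (simp add: walk_def)

lemma walk_Suc [simp]: "walk x (Suc j) = walk x j + x (Suc j)"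
  by (simp add: walk_def)

lemma walk_cong: "(\<And>i. 1 \<le> i \<Longrightarrow> i \<le> j \<Longrightarrow> x i = y i) \<Longrightarrow> walk x j = walk y j"
  by (auto simp: walk_def intro!: sum.cong)

lemma walk_diff: "a \<le> b \<Longrightarrow> walk x b - walk x a = (\<Sum>i\<in>{a<..b}. x i)"
proof (induction b rule: dec_induct)
  case (step b)
  then have "{a<..Suc b} = insert (Suc b) {a<..b}" by auto
  then show ?case using step by simp
qed simp

text \<open>
  The four cases in the definition of the transformed walk are the partial sums of the increments
  at positions \<open>u + 1, \<dots>, d\<close>, then \<open>g + 1, \<dots>, u\<close>, then \<open>1, \<dots>, g\<close>, then \<open>d + 1, \<dots>, n\<close>.
\<close>

lemma walk_face_first:
  assumes e: "face_ends n (walk x) u = (g, d)" and gd: "g < u" "u \<le> d"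
  shows "walk (x \<circ> face_first g d u) j = transformed_walk n (walk x) u j"
proof (induction j)
  case 0
  show ?case using gd
    by (auto simp: transformed_walk_def face_left_def face_right_def e Let_def)
next
  case (Suc j)
  define s where "s = walk x"
  have x: "x k = s k - s (k - 1)" if "0 < k" for k
    using that by (cases k) (auto simp: s_def)
  have s0: "s 0 = 0" by (simp add: s_def)
  have T: "transformed_walk n s u j =
     (if j < d - u then s (u + j) - s u
      else if j < d - g then s (g + (j - (d - u))) + s d - s g - s u
      else if j < d then s (j - (d - g)) + s d - s g
      else s j)" for j
    using e by (simp add: transformed_walk_def face_left_def face_right_def s_def Let_def)
  have "transformed_walk n s u j + x (face_first g d u (Suc j)) = transformed_walk n s u (Suc j)"
  proof -
    \<comment> \<open>In every second case \<open>Suc j\<close> is the start of the next block, where the formula for the walk changes.\<close>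
    consider "Suc j < d - u" | "Suc j = d - u" | "d - u \<le> j" "Suc j < d - g"
      | "d - u \<le> j" "Suc j = d - g" | "d - g \<le> j" "Suc j < d" | "d - g \<le> j" "Suc j = d" | "d \<le> j"
      by linarith
    then show ?thesis
    proof cases
      case 1
      then show ?thesis using gd by (simp add: T face_first_def x)
    next
      case 2
      then have "u + Suc j = d" "u + j = d - 1" "d - u < d - g" "d \<noteq> u" using gd by auto
      with 2 show ?thesis using gd by (simp add: T face_first_def x)
    next
      case 3
      then have "Suc j - (d - u) = Suc (j - (d - u))" by auto
      with 3 show ?thesis using gd by (simp add: T face_first_def x)
    next
      case 4
      then have "Suc j - (d - u) = u - g" "j - (d - u) = u - g - 1" using gd by auto
      with 4 show ?thesis using gd s0 by (cases "g = 0") (auto simp: T face_first_def x)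
    next
      case 5
      then have "Suc j - (d - g) = Suc (j - (d - g))" "\<not> j < d - u" using gd by auto
      with 5 show ?thesis using gd by (simp add: T face_first_def x)
    next
      case 6
      then have "Suc j - (d - g) = g" "j - (d - g) = g - 1" "g > 0" "\<not> j < d - u" using gd by auto
      with 6 show ?thesis using gd by (simp add: T face_first_def x)
    next
      case 7
      then show ?thesis using gd by (auto simp: T face_first_def x)
    qed
  qed
  with Suc show ?case by (simp add: s_def)
qed

definition distinct_means :: "nat \<Rightarrow> (nat \<Rightarrow> real) \<Rightarrow> bool" where
  "distinct_means n x \<longleftrightarrow> (\<forall>A B. A \<subseteq> {1..n} \<and> B \<subseteq> {1..n} \<and> A \<noteq> {} \<and> B \<noteq> {} \<and> A \<noteq> B \<longrightarrow>
     mean_of x A \<noteq> mean_of x B)"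

lemma distinct_means_permute:
  assumes x: "distinct_means n x" and \<sigma>: "\<sigma> permutes {1..n}"
  shows "distinct_means n (x \<circ> \<sigma>)"
proof -
  have inj: "inj_on \<sigma> A" for A using permutes_inj[OF \<sigma>] by (rule inj_on_subset) simp
  have m: "mean_of (x \<circ> \<sigma>) A = mean_of x (\<sigma> ` A)" for A
    by (simp add: mean_of_def sum.reindex[OF inj] card_image[OF inj])
  have sub: "\<sigma> ` A \<subseteq> {1..n} \<longleftrightarrow> A \<subseteq> {1..n}" for A
    using permutes_in_image[OF \<sigma>] by blast
  have eq: "\<sigma> ` A = \<sigma> ` B \<longleftrightarrow> A = B" for A B
    by (rule inj_image_eq_iff[OF permutes_inj[OF \<sigma>]])
  show ?thesis
    unfolding distinct_means_def m
  proof (intro allI impI)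
    fix A B :: "nat set"
    assume "A \<subseteq> {1..n} \<and> B \<subseteq> {1..n} \<and> A \<noteq> {} \<and> B \<noteq> {} \<and> A \<noteq> B"
    then show "mean_of x (\<sigma> ` A) \<noteq> mean_of x (\<sigma> ` B)"
      using x[unfolded distinct_means_def, rule_format, of "\<sigma> ` A" "\<sigma> ` B"] by (simp only: sub eq) simp
  qed
qed

text \<open>
  After subtraction of the mean of the first \<open>k\<close> increments, a generic walk takes distinct values
  at distinct times, except at \<open>0\<close> and \<open>k\<close>: equal values at \<open>a\<close> and \<open>b\<close> mean that the increments in
  \<open>{a<..b}\<close> and in \<open>{0<..k}\<close> have the same mean.
\<close>

lemma walk_chord_ne:
  assumes "distinct_means n y" "a < b" "b \<le> n" "0 < k" "k \<le> n" "(a, b) \<noteq> (0, k)"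
  shows "walk y a - walk y k / real k * real a \<noteq> walk y b - walk y k / real k * real b"
proof
  assume eq: "walk y a - walk y k / real k * real a = walk y b - walk y k / real k * real b"
  have "{a<..b} \<noteq> {0<..k}"
  proof
    assume h: "{a<..b} = {0<..k}"
    then have "Min {a<..b} = Min {0<..k}" "Max {a<..b} = Max {0<..k}" by simp_all
    moreover have "Min {a<..b} = Suc a" "Max {a<..b} = b" if "a < b" for a b :: nat
      using that by (auto intro!: Min_eqI Max_eqI)
    ultimately show False using assms by auto
  qed
  then have "mean_of y {a<..b} \<noteq> mean_of y {0<..k}"
    using assms by (intro assms(1)[unfolded distinct_means_def, rule_format]) auto
  moreover have "mean_of y {a<..b} = (walk y b - walk y a) / (real b - real a)"
    if "a < b" for a b using that by (simp add: mean_of_def walk_diff of_nat_diff)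
  ultimately have "(walk y b - walk y a) / (real b - real a) \<noteq> walk y k / real k"
    using assms by simp
  moreover have "(walk y b - walk y a) = walk y k / real k * (real b - real a)"
    unfolding right_diff_distrib using eq by linarith
  ultimately show False using assms by simp
qed

text \<open>
  The domination of the walk by the line of the face, expressed in the transformed walk. Its part
  before \<open>d - g\<close> is the face run cyclically from \<open>u\<close>, so it is maximal, relative to the slope
  of the face, where the run reaches the end of the face, at time \<open>d - u\<close>. Its remaining part is the
  original walk with the face removed, so it is maximal where the face used to be; this
  is \<open>g\<close> steps after time \<open>d - g\<close>, that is, at time \<open>d\<close>.
\<close>

lemma transformed_walk_maximal:
  fixes s :: "nat \<Rightarrow> real"
  assumes e: "face_ends n s u = (g, d)" and u: "0 < u" "u \<le> n" and s0: "s 0 = 0"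
  defines "T \<equiv> transformed_walk n s u"
  defines "R \<equiv> \<lambda>j. T j - T (d - g) / real (d - g) * real j"
  shows "j < d - g \<Longrightarrow> R j \<le> R (d - u)" and "d - g \<le> j \<Longrightarrow> j \<le> n \<Longrightarrow> R j \<le> R d"
proof -
  have gd: "g < u" "u \<le> d" and h: "hull_edge n s g d"
    using e by (auto simp: face_ends_eq_iff[OF u])
  then have gn: "d \<le> n" unfolding hull_edge_def by auto
  have T: "T j =
     (if j < d - u then s (u + j) - s u
      else if j < d - g then s (g + (j - (d - u))) + s d - s g - s u
      else if j < d then s (j - (d - g)) + s d - s g
      else s j)" for j
    using e by (simp add: T_def transformed_walk_def face_left_def face_right_def Let_def)
  define m where "m = slope s g d"
  have Tk: "T (d - g) = s d - s g"
    using gd s0 by (cases "g = 0") (auto simp: T)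
  then have R: "R j = T j - m * real j" for j
    using gd by (simp add: R_def m_def slope_def of_nat_diff)
  have sd: "s d - m * real d = s g - m * real g"
    using gd by (simp add: m_def slope_def field_simps)
  have below: "s i - m * real i \<le> s g - m * real g" if "i \<le> n" for i
    using h that unfolding hull_edge_def m_def by (simp add: algebra_simps)
  have "d - u < d - g" using gd by auto
  then have Rdu: "R (d - u) = (s g - m * real g) - (s u - m * real u)"
    using gd sd by (simp add: R T of_nat_diff algebra_simps)
  have "\<not> d < d - i" for i by simp
  with sd have Rd: "R d = s g - m * real g"
    by (simp only: R T if_False) simp
  show "R j \<le> R (d - u)" if j: "j < d - g"
  proof (cases "j < d - u")
    case True
    then show ?thesis unfolding Rdu
      using below[of "u + j"] gd gn by (simp add: R T algebra_simps)
  next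
    case False
    then have "real (g + (j - (d - u))) = real g + real j - real d + real u"
      using gd j by (simp add: of_nat_diff)
    moreover have "g + (j - (d - u)) \<le> n" using gd gn j by linarith
    ultimately have "s (g + (j - (d - u))) - m * (real g + real j - real d + real u) \<le> s g - m * real g"
      using below by metis
    with False j sd show ?thesis unfolding Rdu
      by (simp add: R T algebra_simps)
  qed
  show "R j \<le> R d" if j: "d - g \<le> j" "j \<le> n"
  proof (cases "j < d")
    case True
    then have "real (j - (d - g)) = real j - real d + real g"
      using gd j by (simp add: of_nat_diff)
    then have "s (j - (d - g)) - m * (real j - real d + real g) \<le> s g - m * real g"
      using below[of "j - (d - g)"] True gn by (metis diff_le_self less_imp_le order_trans)
    moreover have "\<not> j < d - u" "\<not> j < d - g" using gd j by auto
    ultimately show ?thesis unfolding Rd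
      using True sd by (simp add: R T algebra_simps)
  next
    case False
    then have "\<not> j < d - u" "\<not> j < d - g" by auto
    with False below[OF j(2)] show ?thesis unfolding Rd
      by (simp add: R T)
  qed
qed

definition path_perm :: "nat \<Rightarrow> (nat \<Rightarrow> real) \<Rightarrow> nat \<times> (nat \<Rightarrow> nat) \<Rightarrow> nat \<times> (nat \<Rightarrow> nat)" where
  "path_perm n x = (\<lambda>(u, \<sigma>). case face_ends n (walk (x \<circ> \<sigma>)) u of (g, d) \<Rightarrow>
     (d - g, \<sigma> \<circ> face_first g d u))"

text \<open>
  By genericity, the two maximisers in \<open>transformed_walk_maximal\<close> are unique; they depend only
  on the image pair and determine \<open>d\<close> and \<open>d - u\<close>.
\<close>

lemma path_perm_inj:
  assumes x: "distinct_means n x"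
  shows "inj_on (path_perm n x) ({1..n} \<times> {\<sigma>. \<sigma> permutes {1..n}})"
proof (rule inj_onI, clarify)
  fix u \<sigma> u' \<sigma>'
  assume u: "u \<in> {1..n}" and \<sigma>: "\<sigma> permutes {1..n}"
    and u': "u' \<in> {1..n}" and \<sigma>': "\<sigma>' permutes {1..n}"
    and eq: "path_perm n x (u, \<sigma>) = path_perm n x (u', \<sigma>')"
  obtain g d where e: "face_ends n (walk (x \<circ> \<sigma>)) u = (g, d)" by fastforce
  obtain g' d' where e': "face_ends n (walk (x \<circ> \<sigma>')) u' = (g', d')" by fastforce
  have gd: "g < u" "u \<le> d" "d \<le> n"
    using e u face_ends_eq_iff[of u n] by (auto simp: hull_edge_def)
  have gd': "g' < u'" "u' \<le> d'" "d' \<le> n"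
    using e' u' face_ends_eq_iff[of u' n] by (auto simp: hull_edge_def)
  define \<tau> where "\<tau> = \<sigma> \<circ> face_first g d u"
  define k where "k = d - g"
  have k: "d - g = k" "d' - g' = k" and \<tau>: "\<sigma> \<circ> face_first g d u = \<tau>" "\<sigma>' \<circ> face_first g' d' u' = \<tau>"
    using eq by (auto simp: path_perm_def e e' k_def \<tau>_def)
  define y where "y = x \<circ> \<tau>"
  define R where "R j = walk y j - walk y k / real k * real j" for j
  have T: "transformed_walk n (walk (x \<circ> \<sigma>)) u = walk y"
    using walk_face_first[OF e gd(1,2)] by (auto simp: y_def \<tau>(1)[symmetric] comp_assoc)
  have T': "transformed_walk n (walk (x \<circ> \<sigma>')) u' = walk y"
    using walk_face_first[OF e' gd'(1,2)] by (auto simp: y_def \<tau>(2)[symmetric] comp_assoc)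
  have max: "R j \<le> R (d - u)" "R j \<le> R (d' - u')" if "j < k" for j
    using transformed_walk_maximal(1)[OF e, of j] transformed_walk_maximal(1)[OF e', of j] u u' that
    by (auto simp: T T' k R_def)
  have max': "R j \<le> R d" "R j \<le> R d'" if "k \<le> j" "j \<le> n" for j
    using transformed_walk_maximal(2)[OF e, of j] transformed_walk_maximal(2)[OF e', of j] u u' that
    by (auto simp: T T' k R_def)
  have "\<tau> permutes {1..n}"
    unfolding \<tau>(1)[symmetric] by (rule permutes_compose[OF face_first_permutes[OF gd] \<sigma>])
  then have "distinct_means n y"
    unfolding y_def by (rule distinct_means_permute[OF x])
  then have ne: "R a \<noteq> R b" if "a < b" "b \<le> n" "(a, b) \<noteq> (0, k)" for a b
    unfolding R_def using that gd k by (intro walk_chord_ne) auto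
  have "d = d'"
  proof (rule ccontr)
    assume "d \<noteq> d'"
    moreover have "R d = R d'"
      by (intro antisym max') (use gd gd' k in auto)
    ultimately show False
      using ne[of d d'] ne[of d' d] gd gd' k by (cases d d' rule: linorder_cases) auto
  qed
  have "d - u = d' - u'"
  proof (rule ccontr)
    assume "d - u \<noteq> d' - u'"
    moreover have lt: "d - u < k" "d' - u' < k" "k \<le> n" using gd gd' k by auto
    moreover have "R (d - u) = R (d' - u')"
      by (intro antisym max lt)
    ultimately show False
      using ne[of "d - u" "d' - u'"] ne[of "d' - u'" "d - u"]
      by (cases "d - u" "d' - u'" rule: linorder_cases) auto
  qed
  with \<open>d = d'\<close> gd gd' k have *: "u = u'" "g = g'" by auto
  then have "\<sigma> \<circ> face_first g d u = \<sigma>' \<circ> face_first g d u"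
    using \<tau> \<open>d = d'\<close> by simp
  then have "\<sigma> = \<sigma>'"
    using permutes_surj[OF face_first_permutes[OF gd]] by (simp add: surj_fun_eq[symmetric] fun_eq_iff) (metis surjD)
  with * show "u = u' \<and> \<sigma> = \<sigma>'" by simp
qed

lemma path_perm_bij:
  assumes x: "distinct_means n x"
  shows "bij_betw (path_perm n x) ({1..n} \<times> {\<sigma>. \<sigma> permutes {1..n}}) ({1..n} \<times> {\<sigma>. \<sigma> permutes {1..n}})"
proof -
  have sub: "path_perm n x ` ({1..n} \<times> {\<sigma>. \<sigma> permutes {1..n}}) \<subseteq> {1..n} \<times> {\<sigma>. \<sigma> permutes {1..n}}"
  proof (rule image_subsetI)
    fix p assume "p \<in> {1..n} \<times> {\<sigma>. \<sigma> permutes {1..n}}"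
    then obtain u \<sigma> where p: "p = (u, \<sigma>)" and u: "u \<in> {1..n}" and \<sigma>: "\<sigma> permutes {1..n}"
      by auto
    obtain g d where e: "face_ends n (walk (x \<circ> \<sigma>)) u = (g, d)" by fastforce
    have gd: "g < u" "u \<le> d" "d \<le> n"
      using e u face_ends_eq_iff[of u n] by (auto simp: hull_edge_def)
    then show "path_perm n x p \<in> {1..n} \<times> {\<sigma>. \<sigma> permutes {1..n}}"
      using permutes_compose[OF face_first_permutes[OF gd] \<sigma>] by (auto simp: p path_perm_def e)
  qed
  have "finite ({1..n} \<times> {\<sigma>. \<sigma> permutes {1..n}})"
    by (intro finite_cartesian_product finite_permutations finite_atLeastAtMost)
  from endo_inj_surj[OF this sub path_perm_inj[OF x]] path_perm_inj[OF x] show ?thesis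
    unfolding bij_betw_def by (intro conjI)
qed

section \<open>Measurability\<close>

lemma is_concave_majorant_cong:
  "(\<And>i. i \<le> n \<Longrightarrow> s i = s' i) \<Longrightarrow> is_concave_majorant n s = is_concave_majorant n s'"
  by (auto simp: is_concave_majorant_def fun_eq_iff)

lemma face_ends_cong:
  "(\<And>i. i \<le> n \<Longrightarrow> s i = s' i) \<Longrightarrow> face_ends n s u = face_ends n s' u"
  unfolding face_ends_def using is_concave_majorant_cong[of n s s'] by presburger

lemma transformed_walk_cong:
  assumes s: "\<And>i. i \<le> n \<Longrightarrow> s i = s' i" and u: "0 < u" "u \<le> n" and j: "j \<le> n"
  shows "transformed_walk n s u j = transformed_walk n s' u j"
proof -
  obtain g d where e: "face_ends n s u = (g, d)" by fastforce
  then have gd: "g < u" "u \<le> d" "d \<le> n"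
    using face_ends_eq_iff[OF u] by (auto simp: hull_edge_def)
  have e': "face_ends n s' u = (g, d)" using e face_ends_cong[of n s s'] s by simp
  show ?thesis
    using gd j by (simp add: transformed_walk_def face_left_def face_right_def e e' Let_def s)
qed

text \<open>
  By \<open>face_ends_eq_iff\<close>, each value of \<open>face_ends\<close> is attained on a set cut out by finitely many inequalities.
\<close>

lemma measurable_face_ends:
  assumes s: "\<And>j. j \<le> n \<Longrightarrow> (\<lambda>x. s x j) \<in> borel_measurable N" and u: "0 < u" "u \<le> n"
  shows "(\<lambda>x. face_ends n (s x) u) \<in> N \<rightarrow>\<^sub>M count_space {(g, d). g < u \<and> u \<le> d \<and> d \<le> n}"
  unfolding measurable_count_space_eq2_countable
proof (intro conjI ballI)
  show "(\<lambda>x. face_ends n (s x) u) \<in> space N \<rightarrow> {(g, d). g < u \<and> u \<le> d \<and> d \<le> n}"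
  proof
    show "face_ends n (s x) u \<in> {(g, d). g < u \<and> u \<le> d \<and> d \<le> n}" for x
      using face_ends_eq_iff[OF u, of "s x"]
      by (cases "face_ends n (s x) u") (auto simp: hull_edge_def)
  qed
  fix p assume "p \<in> {(g, d). g < u \<and> u \<le> d \<and> d \<le> n}"
  then obtain g d where p: "p = (g, d)" and gd: "g < u" "u \<le> d" "d \<le> n" by auto
  have [measurable]: "(\<lambda>x. s x g) \<in> borel_measurable N" "(\<lambda>x. s x d) \<in> borel_measurable N"
    using s gd by auto
  have [measurable]: "(\<lambda>x. slope (s x) g d) \<in> borel_measurable N"
    unfolding slope_def by measurable
  have "Measurable.pred N (\<lambda>x. s x i \<le> s x g + slope (s x) g d * (real i - real g))"
    "Measurable.pred N (\<lambda>x. s x i < s x g + slope (s x) g d * (real i - real g))"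
    if "i \<le> n" for i
    using s[OF that] by measurable
  then have "Measurable.pred N (\<lambda>x. hull_edge n (s x) g d)"
    unfolding hull_edge_def
    by (intro pred_intros_logic pred_intros_countable pred_intros_imp') auto
  then have "{x \<in> space N. hull_edge n (s x) g d} \<in> sets N"
    by (simp add: pred_def)
  moreover have "(\<lambda>x. face_ends n (s x) u) -` {p} \<inter> space N = {x \<in> space N. hull_edge n (s x) g d}"
    using face_ends_eq_iff[OF u] gd by (auto simp: p)
  ultimately show "(\<lambda>x. face_ends n (s x) u) -` {p} \<inter> space N \<in> sets N"
    by simp
qed

lemma measurable_transformed_walk:
  assumes s: "\<And>j. j \<le> n \<Longrightarrow> (\<lambda>x. s x j) \<in> borel_measurable N" and u: "0 < u" "u \<le> n"
  shows "(\<lambda>x. (face_right n (s x) u - face_left n (s x) u,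
      \<lambda>j\<in>{0..n}. transformed_walk n (s x) u j))
    \<in> N \<rightarrow>\<^sub>M count_space {1..n} \<Otimes>\<^sub>M (\<Pi>\<^sub>M j\<in>{0..n}. borel)"
proof (rule measurable_Pair)
  note ends = measurable_face_ends[OF s u]
  have "(\<lambda>x. (\<lambda>(g, d). d - g) (face_ends n (s x) u)) \<in> N \<rightarrow>\<^sub>M count_space {1..n}"
    by (rule measurable_compose[OF ends]) auto
  then show "(\<lambda>x. face_right n (s x) u - face_left n (s x) u) \<in> N \<rightarrow>\<^sub>M count_space {1..n}"
    by (simp add: face_left_def face_right_def case_prod_beta)
  define T where "T = (\<lambda>(g, d) s j.
      if j < d - u then s (u + j) - s u
      else if j < d - g then s (g + (j - (d - u))) + s d - s g - s u
      else if j < d then s (j - (d - g)) + s d - s g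
      else (s j :: real))"
  have "(\<lambda>x. T p (s x) j) \<in> borel_measurable N" if "p \<in> {(g, d). g < u \<and> u \<le> d \<and> d \<le> n}" "j \<le> n" for p j
  proof -
    obtain g d where p: "p = (g, d)" "g < u" "u \<le> d" "d \<le> n"
      using \<open>p \<in> _\<close> by auto
    then show ?thesis
      using \<open>j \<le> n\<close>
      by (cases "j < d - u"; cases "j < d - g"; cases "j < d")
        (auto simp: T_def intro!: borel_measurable_add borel_measurable_diff s)
  qed
  then have "(\<lambda>x. T (face_ends n (s x) u) (s x) j) \<in> borel_measurable N" if "j \<le> n" for j
    by (rule measurable_compose_countable'[where f = "\<lambda>p x. T p (s x) j", OF _ ends])
      (use that in \<open>simp_all add: countableI_type\<close>)
  then show "(\<lambda>x. \<lambda>j\<in>{0..n}. transformed_walk n (s x) u j) \<in> N \<rightarrow>\<^sub>M (\<Pi>\<^sub>M j\<in>{0..n}. borel)"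
    by (intro measurable_restrict)
      (simp add: T_def transformed_walk_def face_left_def face_right_def Let_def case_prod_beta)
qed

section \<open>Averaging over permutations\<close>

text \<open>
  Independence and uniformity of \<open>U\<close> turn the law of \<open>f U X\<close> into the average over \<open>u\<close> of the laws of
  \<open>f u X\<close>; by exchangeability, each of these is the average over all \<open>\<sigma>\<close> of the laws for the permuted \<open>X\<close>.
  With both averages inside one integral, identities that hold only after summation over \<open>(u, \<sigma>)\<close> can
  be applied pointwise.
\<close>

lemma (in prob_space) emeasure_uniform_exchangeable:
  fixes X :: "'i \<Rightarrow> 'a \<Rightarrow> 'b" and U :: "'a \<Rightarrow> 'u" and f :: "'u \<Rightarrow> ('i \<Rightarrow> 'b) \<Rightarrow> 'k"
    and I :: "'i set"
  defines "X' \<equiv> \<lambda>\<sigma> \<omega>. \<lambda>i\<in>I. X (\<sigma> i) \<omega>"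
  assumes I: "finite I" and J: "finite J" "J \<noteq> {}"
    and X: "\<And>i. i \<in> I \<Longrightarrow> X i \<in> M \<rightarrow>\<^sub>M N" and exch: "exchangeable M N I X"
    and U: "U \<in> M \<rightarrow>\<^sub>M count_space J"
    and unif: "distr M (count_space J) U = uniform_count_measure J"
    and ind: "indep_set (sets (vimage_algebra (space M) U (count_space J)))
      (sets (vimage_algebra (space M) (X' id) (\<Pi>\<^sub>M i\<in>I. N)))"
    and f: "\<And>u. u \<in> J \<Longrightarrow> f u \<in> (\<Pi>\<^sub>M i\<in>I. N) \<rightarrow>\<^sub>M K"
    and A: "A \<in> sets K"
  shows "emeasure (distr M K (\<lambda>\<omega>. f (U \<omega>) (X' id \<omega>))) A =
    ennreal (1 / (card J * fact (card I))) *
    (\<integral>\<^sup>+\<omega>. (\<Sum>(u, \<sigma>)\<in>J \<times> {\<sigma>. \<sigma> permutes I}. indicator A (f u (X' \<sigma> \<omega>))) \<partial>M)"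
proof -
  have X': "X' \<sigma> \<in> M \<rightarrow>\<^sub>M (\<Pi>\<^sub>M i\<in>I. N)" if "\<sigma> permutes I" for \<sigma>
    unfolding X'_def using X permutes_in_image[OF that] by (intro measurable_restrict) auto
  have X'id: "X' id \<in> M \<rightarrow>\<^sub>M (\<Pi>\<^sub>M i\<in>I. N)"
    by (rule X'[OF permutes_id])
  define B where "B u = f u -` A \<inter> space (\<Pi>\<^sub>M i\<in>I. N)" for u
  have B: "B u \<in> sets (\<Pi>\<^sub>M i\<in>I. N)" if "u \<in> J" for u
    unfolding B_def using f[OF that] A by (rule measurable_sets)
  define E where "E \<sigma> u = X' \<sigma> -` B u \<inter> space M" for \<sigma> u
  have E: "E \<sigma> u \<in> events" if "\<sigma> permutes I" "u \<in> J" for \<sigma> u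
    unfolding E_def using X'[OF that(1)] B[OF that(2)] by (rule measurable_sets)
  have mem_E: "\<omega> \<in> E \<sigma> u \<longleftrightarrow> f u (X' \<sigma> \<omega>) \<in> A" if "\<omega> \<in> space M" "\<sigma> permutes I" for \<omega> \<sigma> u
    using measurable_space[OF X'[OF that(2)] that(1)] that(1) by (auto simp: E_def B_def)
  have "distr M (\<Pi>\<^sub>M i\<in>I. N) (X' \<sigma>) = distr M (\<Pi>\<^sub>M i\<in>I. N) (X' id)" if "\<sigma> permutes I" for \<sigma>
    using exch that by (simp add: exchangeable_def X'_def)
  then have E_perm: "emeasure M (E \<sigma> u) = emeasure M (E id u)" if "\<sigma> permutes I" "u \<in> J" for \<sigma> u
    unfolding E_def using that X' X'id B by (metis emeasure_distr)
  define F where "F u = U -` {u} \<inter> space M" for u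
  have F: "F u \<in> events" "prob (F u) = 1 / card J" if "u \<in> J" for u
  proof -
    have "{u} \<in> sets (count_space J)" using that by simp
    then show "F u \<in> events" unfolding F_def by (rule measurable_sets[OF U])
    have "prob (F u) = measure (distr M (count_space J) U) {u}"
      unfolding F_def using U that by (simp add: measure_distr)
    then show "prob (F u) = 1 / card J"
      unfolding unif using that J by (simp add: measure_uniform_count_measure)
  qed
  have FE: "emeasure M (F u \<inter> E id u) = ennreal (1 / card J) * emeasure M (E id u)" if "u \<in> J" for u
  proof -
    have "F u \<in> sets (vimage_algebra (space M) U (count_space J))"
      unfolding F_def using that by (intro in_vimage_algebra) auto
    moreover have "E id u \<in> sets (vimage_algebra (space M) (X' id) (\<Pi>\<^sub>M i\<in>I. N))"
      unfolding E_def using B[OF that] by (rule in_vimage_algebra)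
    ultimately have "prob (F u \<inter> E id u) = prob (F u) * prob (E id u)"
      by (rule indep_setD[OF ind])
    then show ?thesis
      using F[OF that] by (simp add: emeasure_eq_measure ennreal_mult[symmetric])
  qed
  define c where "c = ennreal (1 / (card J * fact (card I)))"
  have c: "ennreal (1 / card J) = c * of_nat (fact (card I))"
    unfolding c_def ennreal_of_nat_eq_real_of_nat
    by (subst ennreal_mult[symmetric]) auto
  have U_J: "U \<omega> \<in> J" if "\<omega> \<in> space M" for \<omega>
    using measurable_space[OF U that] by simp
  have "(\<lambda>\<omega>. f (U \<omega>) (X' id \<omega>)) \<in> M \<rightarrow>\<^sub>M K"
    by (rule measurable_compose_countable'[where f = "\<lambda>u \<omega>. f u (X' id \<omega>)",
          OF measurable_compose[OF X'id f] U countable_finite[OF J(1)]])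
  then have "emeasure (distr M K (\<lambda>\<omega>. f (U \<omega>) (X' id \<omega>))) A
      = emeasure M ((\<lambda>\<omega>. f (U \<omega>) (X' id \<omega>)) -` A \<inter> space M)"
    using A by (rule emeasure_distr)
  also have "(\<lambda>\<omega>. f (U \<omega>) (X' id \<omega>)) -` A \<inter> space M = (\<Union>u\<in>J. F u \<inter> E id u)"
    using mem_E[OF _ permutes_id] U_J by (auto simp: F_def)
  also have "emeasure M \<dots> = (\<Sum>u\<in>J. emeasure M (F u \<inter> E id u))"
    using F E[OF permutes_id] J
    by (intro sum_emeasure[symmetric]) (auto simp: disjoint_family_on_def F_def)
  also have "\<dots> = (\<Sum>u\<in>J. c * (\<Sum>\<sigma> | \<sigma> permutes I. emeasure M (E \<sigma> u)))"
  proof (intro sum.cong refl)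
    fix u assume u: "u \<in> J"
    have "(\<Sum>\<sigma> | \<sigma> permutes I. emeasure M (E \<sigma> u)) = (\<Sum>\<sigma> | \<sigma> permutes I. emeasure M (E id u))"
      using u by (intro sum.cong refl E_perm) auto
    also have "\<dots> = of_nat (fact (card I)) * emeasure M (E id u)"
      by (simp add: card_permutations[OF refl I])
    finally show "emeasure M (F u \<inter> E id u) = c * (\<Sum>\<sigma> | \<sigma> permutes I. emeasure M (E \<sigma> u))"
      by (simp only: FE[OF u] c mult.assoc)
  qed
  also have "\<dots> = c * (\<Sum>(u, \<sigma>)\<in>J \<times> {\<sigma>. \<sigma> permutes I}. emeasure M (E \<sigma> u))"
    by (simp add: sum_distrib_left[symmetric] sum.cartesian_product)
  also have "(\<Sum>(u, \<sigma>)\<in>J \<times> {\<sigma>. \<sigma> permutes I}. emeasure M (E \<sigma> u))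
      = (\<Sum>p\<in>J \<times> {\<sigma>. \<sigma> permutes I}. \<integral>\<^sup>+\<omega>. indicator (E (snd p) (fst p)) \<omega> \<partial>M)"
    by (intro sum.cong refl) (auto simp: E)
  also have "\<dots> = (\<integral>\<^sup>+\<omega>. (\<Sum>p\<in>J \<times> {\<sigma>. \<sigma> permutes I}. indicator (E (snd p) (fst p)) \<omega>) \<partial>M)"
    by (intro nn_integral_sum[symmetric]) (auto intro!: borel_measurable_indicator E)
  also have "\<dots> = (\<integral>\<^sup>+\<omega>. (\<Sum>(u, \<sigma>)\<in>J \<times> {\<sigma>. \<sigma> permutes I}. indicator A (f u (X' \<sigma> \<omega>))) \<partial>M)"
    by (intro nn_integral_cong sum.cong refl) (auto simp: mem_E split: split_indicator)
  finally show ?thesis unfolding c_def .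
qed

theorem theorem26:
  fixes M :: "'a measure" and n :: nat and X :: "nat \<Rightarrow> 'a \<Rightarrow> real" and U :: "'a \<Rightarrow> nat"
    and S :: "'a \<Rightarrow> nat \<Rightarrow> real" and g d :: "'a \<Rightarrow> nat"
  defines "S \<equiv> \<lambda>\<omega>. walk (\<lambda>i. X i \<omega>)"
    and "g \<equiv> \<lambda>\<omega>. face_left n (S \<omega>) (U \<omega>)"
    and "d \<equiv> \<lambda>\<omega>. face_right n (S \<omega>) (U \<omega>)"
  assumes "prob_space M"
    and "1 \<le> n"
    and "\<And>i. i \<in> {1..n} \<Longrightarrow> X i \<in> borel_measurable M"
    and "exchangeable M borel {1..n} X"
    and "AE \<omega> in M. \<forall>A B. A \<subseteq> {1..n} \<and> B \<subseteq> {1..n} \<and> A \<noteq> {} \<and> B \<noteq> {} \<and> A \<noteq> B \<longrightarrow>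
           mean_of (\<lambda>i. X i \<omega>) A \<noteq> mean_of (\<lambda>i. X i \<omega>) B"
    and "U \<in> measurable M (count_space {1..n})"
    and "distr M (count_space {1..n}) U = uniform_count_measure {1..n}"
    and "prob_space.indep_set M
           (sets (vimage_algebra (space M) U (count_space {1..n})))
           (sets (vimage_algebra (space M) (\<lambda>\<omega>. \<lambda>i\<in>{1..n}. X i \<omega>) (\<Pi>\<^sub>M i\<in>{1..n}. borel)))"
  shows "distr M (count_space {1..n} \<Otimes>\<^sub>M (\<Pi>\<^sub>M j\<in>{0..n}. borel))
           (\<lambda>\<omega>. (U \<omega>, \<lambda>j\<in>{0..n}. S \<omega> j)) =
         distr M (count_space {1..n} \<Otimes>\<^sub>M (\<Pi>\<^sub>M j\<in>{0..n}. borel))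
           (\<lambda>\<omega>. (d \<omega> - g \<omega>, \<lambda>j\<in>{0..n}. transformed_walk n (S \<omega>) (U \<omega>) j))"
    (is "distr M ?K ?L = distr M ?K ?R")
proof -
  interpret prob_space M by fact
  define P where "P = {1..n} \<times> {\<sigma>. \<sigma> permutes {1..n}}"
  define N :: "(nat \<Rightarrow> real) measure" where "N = (\<Pi>\<^sub>M i\<in>{1..n}. borel)"
  define X' where "X' \<sigma> \<omega> = (\<lambda>i\<in>{1..n}. X (\<sigma> i) \<omega>)" for \<sigma> \<omega>
  \<comment> \<open>\<open>h\<close> and \<open>h'\<close> express the two sides as functions of the index and the vector of increments.\<close>
  define h where "h u x = (u, \<lambda>j\<in>{0..n}. walk x j)" for u :: nat and x
  define h' where "h' u x = (face_right n (walk x) u - face_left n (walk x) u,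
      \<lambda>j\<in>{0..n}. transformed_walk n (walk x) u j)" for u x
  define c where "c = ennreal (1 / (card {1..n} * fact (card {1..n})))"
  have U_n: "U \<omega> \<in> {1..n}" if "\<omega> \<in> space M" for \<omega>
    using measurable_space[OF assms(9) that] by simp
  have walk_X': "walk (X' \<sigma> \<omega>) j = walk ((\<lambda>i. X i \<omega>) \<circ> \<sigma>) j" if "j \<le> n" for \<sigma> \<omega> j
    using that by (intro walk_cong) (auto simp: X'_def)
  have h_X': "h u (X' \<sigma> \<omega>) = h u ((\<lambda>i. X i \<omega>) \<circ> \<sigma>)" for u \<sigma> \<omega>
    by (auto simp: h_def walk_X')
  have h'_X': "h' u (X' \<sigma> \<omega>) = h' u ((\<lambda>i. X i \<omega>) \<circ> \<sigma>)" if "u \<in> {1..n}" for u \<sigma> \<omega>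
  proof -
    have "face_ends n (walk (X' \<sigma> \<omega>)) u = face_ends n (walk ((\<lambda>i. X i \<omega>) \<circ> \<sigma>)) u"
      by (rule face_ends_cong[OF walk_X'])
    moreover have "transformed_walk n (walk (X' \<sigma> \<omega>)) u j
        = transformed_walk n (walk ((\<lambda>i. X i \<omega>) \<circ> \<sigma>)) u j" if "j \<le> n" for j
      using that \<open>u \<in> {1..n}\<close> by (intro transformed_walk_cong[OF walk_X']) auto
    ultimately show ?thesis
      by (auto simp: h'_def face_left_def face_right_def)
  qed
  have walk_meas: "(\<lambda>x. walk x j) \<in> borel_measurable N" if "j \<le> n" for j
    unfolding walk_def N_def using that by (intro borel_measurable_sum measurable_component_singleton) auto
  have h_meas: "h u \<in> N \<rightarrow>\<^sub>M ?K" if "u \<in> {1..n}" for u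
    unfolding h_def using that walk_meas by (intro measurable_Pair measurable_restrict) auto
  have h'_meas: "h' u \<in> N \<rightarrow>\<^sub>M ?K" if "u \<in> {1..n}" for u
    unfolding h'_def using that by (intro measurable_transformed_walk walk_meas) auto
  have symm: "emeasure (distr M ?K (\<lambda>\<omega>. f (U \<omega>) (X' id \<omega>))) A =
      c * (\<integral>\<^sup>+\<omega>. (\<Sum>(u, \<sigma>)\<in>P. indicator A (f u (X' \<sigma> \<omega>))) \<partial>M)"
    if "\<And>u. u \<in> {1..n} \<Longrightarrow> f u \<in> N \<rightarrow>\<^sub>M ?K" "A \<in> sets ?K" for f A
    unfolding c_def P_def X'_def
    using assms(5,6,7,9,10,11) that(1)[unfolded N_def] that(2)
    by (intro emeasure_uniform_exchangeable) auto
  \<comment> \<open>Replacing \<open>h'\<close> by \<open>h\<close> amounts to applying the bijection.\<close>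
  have matching: "h' u (x \<circ> \<sigma>) = h k (x \<circ> \<tau>)"
    if "u \<in> {1..n}" "path_perm n x (u, \<sigma>) = (k, \<tau>)" for u \<sigma> k \<tau> x
  proof -
    obtain g d where e: "face_ends n (walk (x \<circ> \<sigma>)) u = (g, d)" by fastforce
    then have gd: "g < u" "u \<le> d"
      using that(1) face_ends_eq_iff[of u n] by auto
    show ?thesis
      using walk_face_first[OF e gd] that(2) e
      by (auto simp: h_def h'_def path_perm_def face_left_def face_right_def comp_assoc[symmetric])
  qed
  have "AE \<omega> in M. distinct_means n (\<lambda>i. X i \<omega>)"
    using assms(8) by (simp add: distinct_means_def)
  then have sums: "AE \<omega> in M. (\<Sum>(u, \<sigma>)\<in>P. indicator A (h' u (X' \<sigma> \<omega>)) :: ennreal) =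
      (\<Sum>(u, \<sigma>)\<in>P. indicator A (h u (X' \<sigma> \<omega>)))" for A
  proof eventually_elim
    case (elim \<omega>)
    let ?x = "\<lambda>i. X i \<omega>"
    have "(\<Sum>(u, \<sigma>)\<in>P. indicator A (h' u (X' \<sigma> \<omega>)) :: ennreal) =
        (\<Sum>p\<in>P. (\<lambda>(u, \<sigma>). indicator A (h u (?x \<circ> \<sigma>))) (path_perm n ?x p))"
      by (intro sum.cong refl) (auto simp: P_def h'_X' matching split: prod.splits)
    also have "\<dots> = (\<Sum>(u, \<sigma>)\<in>P. indicator A (h u (?x \<circ> \<sigma>)))"
      unfolding P_def by (rule sum.reindex_bij_betw[OF path_perm_bij[OF elim]])
    finally show ?case by (simp add: h_X')
  qed
  have "distr M ?K (\<lambda>\<omega>. h (U \<omega>) (X' id \<omega>)) = distr M ?K (\<lambda>\<omega>. h' (U \<omega>) (X' id \<omega>))"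
  proof (rule measure_eqI)
    fix A assume "A \<in> sets (distr M ?K (\<lambda>\<omega>. h (U \<omega>) (X' id \<omega>)))"
    then have A: "A \<in> sets ?K" by (simp only: sets_distr)
    show "emeasure (distr M ?K (\<lambda>\<omega>. h (U \<omega>) (X' id \<omega>))) A =
        emeasure (distr M ?K (\<lambda>\<omega>. h' (U \<omega>) (X' id \<omega>))) A"
      by (subst (1 2) symm; simp only: h_meas h'_meas A nn_integral_cong_AE[OF sums])
  qed simp
  moreover have "distr M ?K ?L = distr M ?K (\<lambda>\<omega>. h (U \<omega>) (X' id \<omega>))"
    by (intro distr_cong refl) (unfold h_X', simp add: h_def S_def)
  moreover have "distr M ?K ?R = distr M ?K (\<lambda>\<omega>. h' (U \<omega>) (X' id \<omega>))"
    by (intro distr_cong refl) (subst h'_X'[OF U_n], simp_all add: h'_def S_def g_def d_def)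
  ultimately show ?thesis by simp
qed

end
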